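(* Let $\mathfrak{g}=A_{5,3}$ and let $\langle\cdot,\cdot\rangle$ be an inner product on $\mathfrak{g}$. Let $\eta>0$ and let $\{v_1,\dots,v_5\}$ be a basis of $\mathfrak{g}$, orthonormal with respect to $\eta\langle\cdot,\cdot\rangle$, whose only nonzero brackets (up to antisymmetry) are $[v_1,v_2]=\alpha v_3+\beta v_4$, $[v_1,v_3]=\gamma v_4+\delta v_5$, $[v_2,v_3]=\varepsilon v_5$, with $\alpha,\gamma,\varepsilon>0$ and $\beta,\delta\in\mathbb{R}$. Then $\langle\cdot,\cdot\rangle$ is a Schouten like metric if and only if $\beta=\delta=0$ and $\varepsilon=\gamma=\frac{\sqrt{3}}{2}\alpha$.
   Context: $A_{5,3}$ is the five-dimensional real nilpotent Lie algebra having a basis with the brackets displayed in the claim. An inner product on $\mathfrak{g}$ is identified with the left-invariant Riemannian metric $g$ it induces on the simply connected Lie group $G$ with Lie algebra $\mathfrak{g}$. Let $ric_g$ be the Ricci curvature tensor of $(G,g)$ (Levi-Civita connection), viewed as a symmetric bilinear form on $\mathfrak{g}$; since $\mathfrak{g}$ is nilpotent, $ric_g(u,v)=-\frac12\mathrm{tr}(ad_u\circ ad_v^* )-\frac14\mathrm{tr}(J_u\circ J_v)$, where $ad_uv=[u,v]$, $ad_v^*$ is the $g$-transpose of $ad_v$, and $J_uv=ad_v^*u$. The Ricci operator $Ric_g$ is defined by $ric_g(u,v)=g(Ric_g(u),v)$ and $s=\mathrm{tr}(Ric_g)$ is the scalar curvature. A derivation $D$ of $\mathfrak{g}$ is symmetric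 with respect to $g$ if $g(Du,v)=g(u,Dv)$ for all $u,v$. The metric $g$ is a Schouten like metric if there are real numbers $\lambda_0,c$ and a derivation $D$ of $\mathfrak{g}$, symmetric with respect to $g$, such that $ric_g(X,Y)=(s\lambda_0+c)g(X,Y)+g(D(X),Y)$ for all $X,Y\in\mathfrak{g}$. *)

theory Defs
  imports "HOL-Analysis.Analysis"
begin

definition lie_algebra :: "('a::real_vector \<Rightarrow> 'a \<Rightarrow> 'a) \<Rightarrow> bool" where
  "lie_algebra B \<longleftrightarrow> bilinear B \<and> (\<forall>x. B x x = 0) \<and>
     (\<forall>x y z. B x (B y z) + B y (B z x) + B z (B x y) = 0)"

definition inner_product :: "('a::real_vector \<Rightarrow> 'a \<Rightarrow> real) \<Rightarrow> bool" where
  "inner_product g \<longleftrightarrow> bilinear g \<and> (\<forall>x y. g x y = g y x) \<and> (\<forall>x. x \<noteq> 0 \<longrightarrow> g x x > 0)"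

definition basis5 :: "(nat \<Rightarrow> 'a::real_vector) \<Rightarrow> bool" where
  "basis5 v \<longleftrightarrow> inj_on v {1..5} \<and> independent (v ` {1..5}) \<and> span (v ` {1..5}) = UNIV"

definition orthonormal5 :: "('a::real_vector \<Rightarrow> 'a \<Rightarrow> real) \<Rightarrow> (nat \<Rightarrow> 'a) \<Rightarrow> bool" where
  "orthonormal5 g v \<longleftrightarrow> (\<forall>i\<in>{1..5}. \<forall>j\<in>{1..5}. g (v i) (v j) = (if i = j then 1 else 0))"

definition A53_brackets ::
  "('a::real_vector \<Rightarrow> 'a \<Rightarrow> 'a) \<Rightarrow> (nat \<Rightarrow> 'a) \<Rightarrow> real \<Rightarrow> real \<Rightarrow> real \<Rightarrow> real \<Rightarrow> real \<Rightarrow> bool" where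
  "A53_brackets B v \<alpha> \<beta> \<gamma> \<delta> \<epsilon> \<longleftrightarrow>
     B (v 1) (v 2) = \<alpha> *\<^sub>R v 3 + \<beta> *\<^sub>R v 4 \<and>
     B (v 1) (v 3) = \<gamma> *\<^sub>R v 4 + \<delta> *\<^sub>R v 5 \<and>
     B (v 2) (v 3) = \<epsilon> *\<^sub>R v 5 \<and>
     B (v 1) (v 4) = 0 \<and> B (v 1) (v 5) = 0 \<and>
     B (v 2) (v 4) = 0 \<and> B (v 2) (v 5) = 0 \<and>
     B (v 3) (v 4) = 0 \<and> B (v 3) (v 5) = 0 \<and>
     B (v 4) (v 5) = 0"

(* The usual normal form of A_{5,3}: [x1,x2] = x3, [x1,x3] = x4, [x2,x3] = x5. *)
definition is_A53 :: "('a::real_vector \<Rightarrow> 'a \<Rightarrow> 'a) \<Rightarrow> bool" where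
  "is_A53 B \<longleftrightarrow> lie_algebra B \<and> (\<exists>x. basis5 x \<and> A53_brackets B x 1 0 1 0 1)"

(* Trace of an endomorphism of a finite-dimensional space; the choice of basis is
   irrelevant by lin_trace_basis below. *)
definition lin_trace :: "('a::real_vector \<Rightarrow> 'a) \<Rightarrow> real" where
  "lin_trace f = (let b = (SOME b. independent b \<and> span b = UNIV)
                  in \<Sum>x\<in>b. representation b (f x) x)"

(* On left-invariant vector fields the functions g(X,Y) are constant, so the Levi-Civita
   connection of the left-invariant metric is determined by a bilinear product on the Lie
   algebra, and compatibility with g reads g(\<nabla>_u v, w) + g(v, \<nabla>_u w) = 0. *)
definition is_levi_civita ::
  "('a::real_vector \<Rightarrow> 'a \<Rightarrow> 'a) \<Rightarrow> ('a \<Rightarrow> 'a \<Rightarrow> real) \<Rightarrow> ('a \<Rightarrow> 'a \<Rightarrow> 'a) \<Rightarrow> bool" where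
  "is_levi_civita B g N \<longleftrightarrow> bilinear N \<and>
     (\<forall>u v. N u v - N v u = B u v) \<and>
     (\<forall>u v w. g (N u v) w + g v (N u w) = 0)"

definition levi_civita ::
  "('a::real_vector \<Rightarrow> 'a \<Rightarrow> 'a) \<Rightarrow> ('a \<Rightarrow> 'a \<Rightarrow> real) \<Rightarrow> 'a \<Rightarrow> 'a \<Rightarrow> 'a" where
  "levi_civita B g = (THE N. is_levi_civita B g N)"

definition curvature ::
  "('a::real_vector \<Rightarrow> 'a \<Rightarrow> 'a) \<Rightarrow> ('a \<Rightarrow> 'a \<Rightarrow> real) \<Rightarrow> 'a \<Rightarrow> 'a \<Rightarrow> 'a \<Rightarrow> 'a" where
  "curvature B g u v w = (let N = levi_civita B g
     in N u (N v w) - N v (N u w) - N (B u v) w)"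

definition ricci :: "('a::real_vector \<Rightarrow> 'a \<Rightarrow> 'a) \<Rightarrow> ('a \<Rightarrow> 'a \<Rightarrow> real) \<Rightarrow> 'a \<Rightarrow> 'a \<Rightarrow> real" where
  "ricci B g u v = lin_trace (\<lambda>w. curvature B g w u v)"

definition ricci_operator :: "('a::real_vector \<Rightarrow> 'a \<Rightarrow> 'a) \<Rightarrow> ('a \<Rightarrow> 'a \<Rightarrow> real) \<Rightarrow> 'a \<Rightarrow> 'a" where
  "ricci_operator B g = (THE A. \<forall>u v. ricci B g u v = g (A u) v)"

definition scalar_curvature :: "('a::real_vector \<Rightarrow> 'a \<Rightarrow> 'a) \<Rightarrow> ('a \<Rightarrow> 'a \<Rightarrow> real) \<Rightarrow> real" where
  "scalar_curvature B g = lin_trace (ricci_operator B g)"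

definition derivation :: "('a::real_vector \<Rightarrow> 'a \<Rightarrow> 'a) \<Rightarrow> ('a \<Rightarrow> 'a) \<Rightarrow> bool" where
  "derivation B D \<longleftrightarrow> linear D \<and> (\<forall>x y. D (B x y) = B (D x) y + B x (D y))"

definition g_symmetric :: "('a::real_vector \<Rightarrow> 'a \<Rightarrow> real) \<Rightarrow> ('a \<Rightarrow> 'a) \<Rightarrow> bool" where
  "g_symmetric g D \<longleftrightarrow> (\<forall>u v. g (D u) v = g u (D v))"

definition schouten_like :: "('a::real_vector \<Rightarrow> 'a \<Rightarrow> 'a) \<Rightarrow> ('a \<Rightarrow> 'a \<Rightarrow> real) \<Rightarrow> bool" where
  "schouten_like B g \<longleftrightarrow> (\<exists>l0 c D. derivation B D \<and> g_symmetric g D \<and>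
     (\<forall>X Y. ricci B g X Y = (scalar_curvature B g * l0 + c) * g X Y + g (D X) Y))"

lemma lin_trace_basis:
  assumes f: "linear f" and c: "independent c" "span c = UNIV" "finite c"
  shows "lin_trace f = (\<Sum>x\<in>c. representation c (f x) x)"
proof -
  define b where "b = (SOME b::'a set. independent b \<and> span b = UNIV)"
  have b: "independent b \<and> span b = UNIV"
    unfolding b_def by (rule someI) (use c in blast)
  have fb: "finite b"
    using b c independent_span_bound[of c b] by auto
  have exp: "(\<Sum>y\<in>d. representation d x y *\<^sub>R y) = x"
    if "independent d" "span d = UNIV" "finite d" for d and x :: 'a
    using that by (intro real_vector.sum_representation_eq) auto
  have lr: "linear (\<lambda>x. representation d x y)" if "independent d" "span d = UNIV" for d and y :: 'a
    using that
    by (intro linearI) (auto simp: real_vector.representation_add real_vector.representation_scale)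
  have "(\<Sum>x\<in>b. representation b (f x) x)
      = (\<Sum>x\<in>b. \<Sum>y\<in>c. representation c x y * representation b (f y) x)"
  proof (rule sum.cong[OF refl])
    fix x assume "x \<in> b"
    have "representation b (f x) x = representation b (f (\<Sum>y\<in>c. representation c x y *\<^sub>R y)) x"
      using exp c by simp
    also have "\<dots> = (\<Sum>y\<in>c. representation c x y * representation b (f y) x)"
      using b by (simp add: f[THEN linear_sum] f[THEN linear_scale]
          lr[of b x, THEN linear_sum] lr[of b x, THEN linear_scale])
    finally show "representation b (f x) x = \<dots>" .
  qed
  also have "\<dots> = (\<Sum>y\<in>c. \<Sum>x\<in>b. representation b (f y) x * representation c x y)"
    by (subst sum.swap) (simp add: mult.commute)
  also have "\<dots> = (\<Sum>y\<in>c. representation c (f y) y)"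
  proof (rule sum.cong[OF refl])
    fix y assume "y \<in> c"
    have "representation c (f y) y = representation c (\<Sum>x\<in>b. representation b (f y) x *\<^sub>R x) y"
      using exp b fb by simp
    also have "\<dots> = (\<Sum>x\<in>b. representation b (f y) x * representation c x y)"
      using c by (simp add: lr[of c y, THEN linear_sum] lr[of c y, THEN linear_scale])
    finally show "(\<Sum>x\<in>b. representation b (f y) x * representation c x y) = representation c (f y) y" ..
  qed
  finally show ?thesis
    unfolding lin_trace_def Let_def b_def[symmetric] .
qed

locale orthonormal_lie_algebra =
  fixes B :: "'a::real_vector \<Rightarrow> 'a \<Rightarrow> 'a" and g :: "'a \<Rightarrow> 'a \<Rightarrow> real" and E :: "'a set"
  assumes lie: "lie_algebra B" and ip: "inner_product g"
    and fin: "finite E" and span: "span E = UNIV"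
    and on: "\<And>x y. x \<in> E \<Longrightarrow> y \<in> E \<Longrightarrow> g x y = (if x = y then 1 else 0)"
begin

lemma lin: "linear (g x)" "linear (\<lambda>x. g x y)" "linear (B x)" "linear (\<lambda>x. B x y)"
  using lie ip by (auto simp: lie_algebra_def inner_product_def bilinear_def)

lemmas lins =
  lin[THEN linear_add] lin[THEN linear_diff] lin[THEN linear_neg] lin[THEN linear_0]
  lin[THEN linear_scale] lin[THEN linear_sum]

lemma gsym: "g x y = g y x" and gpos: "x \<noteq> 0 \<Longrightarrow> g x x > 0"
  using ip by (auto simp: inner_product_def)

lemma Balt: "B x x = 0"
  using lie by (auto simp: lie_algebra_def)

lemma Bskew: "B x y = - B y x"
proof -
  have "B x (x + y) + B y (x + y) = 0"
    using Balt[of "x + y"] by (simp only: linear_add[OF lin(4)])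
  then have "B x y + B y x = 0" by (simp add: lins Balt)
  then show ?thesis by (rule eq_neg_iff_add_eq_0[THEN iffD2])
qed

lemma Jacobi: "B x (B y z) + B y (B z x) + B z (B x y) = 0"
  using lie by (auto simp: lie_algebra_def)

lemma g_eqI: "(\<And>z. g x z = g y z) \<Longrightarrow> x = y"
  using gpos[of "x - y"] by (force simp: lins)

lemma independent_E: "independent E"
proof (rule independent_if_scalars_zero[OF fin])
  fix u x assume s: "(\<Sum>x\<in>E. u x *\<^sub>R x) = 0" and x: "x \<in> E"
  have "g (\<Sum>x\<in>E. u x *\<^sub>R x) x = (\<Sum>y\<in>E. u y * (if y = x then 1 else 0))"
    by (simp add: lins on x cong: sum.cong)
  then show "u x = 0" using s x fin by (simp add: lins if_distrib cong: if_cong)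
qed

lemma expand: "(\<Sum>e\<in>E. g x e *\<^sub>R e) = x"
proof -
  have "representation E x e = g x e" if e: "e \<in> E" for e
  proof -
    have "x = (\<Sum>y\<in>E. representation E x y *\<^sub>R y)"
      using independent_E span fin
      by (intro real_vector.sum_representation_eq[symmetric]) auto
    then have "g x e = g (\<Sum>y\<in>E. representation E x y *\<^sub>R y) e" by simp
    also have "\<dots> = (\<Sum>y\<in>E. representation E x y * (if y = e then 1 else 0))"
      by (simp add: lins on e cong: sum.cong)
    also have "\<dots> = representation E x e" using e fin by (simp add: if_distrib cong: if_cong)
    finally show ?thesis ..
  qed
  then have "(\<Sum>e\<in>E. g x e *\<^sub>R e) = (\<Sum>e\<in>E. representation E x e *\<^sub>R e)" by simp
  also have "\<dots> = x"
    using independent_E span fin by (intro real_vector.sum_representation_eq) auto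
  finally show ?thesis .
qed

lemma parseval: "(\<Sum>e\<in>E. g x e * g e y) = g x y"
proof -
  have "g x y = g (\<Sum>e\<in>E. g x e *\<^sub>R e) y" by (simp add: expand)
  then show ?thesis by (simp add: lins)
qed

lemma riesz: "linear \<phi> \<Longrightarrow> g (\<Sum>e\<in>E. \<phi> e *\<^sub>R e) y = \<phi> y"
proof -
  assume l: "linear \<phi>"
  have "\<phi> y = \<phi> (\<Sum>e\<in>E. g y e *\<^sub>R e)" by (simp add: expand)
  also have "\<dots> = (\<Sum>e\<in>E. g y e * \<phi> e)" using l by (simp add: linear_sum linear_scale)
  finally show ?thesis by (simp add: lins gsym mult.commute)
qed

lemma trace_eq: "linear f \<Longrightarrow> lin_trace f = (\<Sum>e\<in>E. g (f e) e)"
proof -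
  assume f: "linear f"
  have "representation E x e = g x e" if e: "e \<in> E" for e x
  proof -
    have "representation E (\<Sum>y\<in>E. g x y *\<^sub>R y) e = (\<Sum>y\<in>E. g x y * (if y = e then 1 else 0))"
      using independent_E span
      by (auto simp: real_vector.representation_sum real_vector.representation_scale
          real_vector.representation_basis intro!: sum.cong)
    then show ?thesis using e fin by (simp add: expand if_distrib cong: if_cong)
  qed
  then show ?thesis
    using lin_trace_basis[OF f independent_E span fin] by simp
qed

lemma is_levi_civita_koszul:
  assumes "is_levi_civita B g N"
  shows "2 * g (N u v) w = g (B u v) w - g (B v w) u + g (B w u) v"
proof -
  have t: "B x y = N x y - N y x" and m: "g (N x y) z = - g (N x z) y" for x y z
    using assms gsym[of y "N x z"] unfolding is_levi_civita_def
    by (metis, metis add_eq_0_iff minus_equation_iff)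
  show ?thesis
    using m[of u v w] m[of v u w] m[of w u v] by (simp add: t lins)
qed

lemma levi_civita_ex1: "\<exists>!N. is_levi_civita B g N"
proof (rule ex_ex1I)
  define \<phi> where "\<phi> = (\<lambda>u v w. (g (B u v) w - g (B v w) u + g (B w u) v) / 2)"
  define N where "N = (\<lambda>u v. \<Sum>e\<in>E. \<phi> u v e *\<^sub>R e)"
  have l: "linear (\<phi> u v)" for u v
    by (rule linearI) (auto simp: \<phi>_def lins field_simps)
  have gN: "g (N u v) w = \<phi> u v w" for u v w
    unfolding N_def by (rule riesz[OF l])
  have "bilinear N"
    unfolding bilinear_def
    by (intro conjI allI linearI g_eqI) (auto simp: gN lins \<phi>_def field_simps)
  moreover have "N u v - N v u = B u v" for u v
  proof (rule g_eqI)
    fix z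
    show "g (N u v - N v u) z = g (B u v) z"
      by (simp add: gN lins \<phi>_def Bskew[of v u] Bskew[of z u] Bskew[of z v] field_simps)
  qed
  moreover have "g (N u v) w + g v (N u w) = 0" for u v w
  proof -
    have "g v (N u w) = \<phi> u w v" by (simp add: gsym[of v "N u w"] gN)
    then show ?thesis
      by (simp add: gN \<phi>_def Bskew[of w v] Bskew[of w u] Bskew[of v u] lins field_simps)
  qed
  ultimately show "\<exists>N. is_levi_civita B g N"
    unfolding is_levi_civita_def by blast
next
  fix N M assume N: "is_levi_civita B g N" and M: "is_levi_civita B g M"
  have "N u v = M u v" for u v
    by (rule g_eqI)
      (use is_levi_civita_koszul[OF N, of u v] is_levi_civita_koszul[OF M, of u v] in
        \<open>metis mult_cancel_left zero_neq_numeral\<close>)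
  then show "N = M" by blast
qed

lemma levi_civita: "is_levi_civita B g (levi_civita B g)"
  unfolding levi_civita_def by (rule theI'[OF levi_civita_ex1])

(* The traces assumed to vanish do so in every nilpotent Lie algebra. *)
lemma ricci_nilpotent:
  assumes tr1: "\<And>u. lin_trace (B u) = 0"
    and tr2: "\<And>u v. lin_trace (B u \<circ> B v) = 0"
    and adj: "\<And>u x y. g (B u x) y = g x (adt u y)"
  shows "ricci B g u v = - (1/2) * lin_trace (B u \<circ> adt v)
           - (1/4) * lin_trace ((\<lambda>x. adt x u) \<circ> (\<lambda>x. adt x v))"
proof -
  define N where "N = levi_civita B g"
  note LC = levi_civita[folded N_def]
  note K = is_levi_civita_koszul[OF LC]
  have linN: "linear (N x)" "linear (\<lambda>x. N x y)" for x y
    using LC by (auto simp: is_levi_civita_def bilinear_def)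
  note linsN = linN[THEN linear_add] linN[THEN linear_diff] linN[THEN linear_scale]
  have met: "g (N x y) z = - g y (N x z)" for x y z
    using LC unfolding is_levi_civita_def by (metis add_eq_0_iff minus_minus)
  have adl: "linear (adt x)" "linear (\<lambda>x. adt x y)" for x y
    by (rule linearI; rule g_eqI; simp add: lins gsym[of "adt _ _"] adj[symmetric])+
  define P where "P = (\<lambda>x e f. g (B x e) f)"
  define Q where "Q = (\<lambda>x e f. g (B e f) x)"
  have Qsk: "Q x e f = - Q x f e" for x e f
    unfolding Q_def by (subst Bskew) (simp add: lins)
  define S1 where "S1 = (\<Sum>e\<in>E. g (B u e) (B v e))"
  define S2 where "S2 = (\<Sum>e\<in>E. \<Sum>f\<in>E. Q u e f * Q v e f)"
  define S3 where "S3 = (\<Sum>e\<in>E. g (B e (B u e)) v)"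
  have "ricci B g u v = (\<Sum>e\<in>E. g (curvature B g e u v) e)"
    unfolding ricci_def
    by (rule trace_eq, rule linearI)
      (auto simp: curvature_def Let_def N_def[symmetric] lins linsN algebra_simps)
  also have "\<dots> = (\<Sum>e\<in>E. g (N e (N u v)) e) + (\<Sum>e\<in>E. g (N e v) (N u e))
      - (\<Sum>e\<in>E. g (N (B e u) v) e)"
    by (simp add: curvature_def Let_def N_def[symmetric] lins sum.distrib sum_subtractf met[of u])
  also have "(\<Sum>e\<in>E. g (N e (N u v)) e) = 0"
  proof -
    have "g (N e w) e = - g (B w e) e" for e w
      using K[of e w e] by (simp add: Bskew[of e w] Balt lins)
    then show ?thesis
      using tr1[of "N u v"] by (simp add: trace_eq lin sum_negf)
  qed
  also have "(\<Sum>e\<in>E. g (N (B e u) v) e) = S1 / 2 - S3 / 2"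
  proof -
    have "2 * g (N (B e u) v) e = g ((B v \<circ> B u) e) e + g (B u e) (B v e) - g (B e (B u e)) v" for e
      using K[of "B e u" v e]
      by (simp add: Bskew[of "B e u" v] Bskew[of e u] Bskew[of _ "B u e"] lins gsym[of "B v e"])
    then have "2 * (\<Sum>e\<in>E. g (N (B e u) v) e) = lin_trace (B v \<circ> B u) + S1 - S3"
      unfolding S1_def S3_def
      by (subst trace_eq) (simp_all add: sum_distrib_left sum.distrib sum_subtractf lin linear_compose)
    then show ?thesis by (simp add: tr2)
  qed
  also have "(\<Sum>e\<in>E. g (N e v) (N u e)) = S2 / 4 - S3 / 2"
  proof -
    have "4 * g (N e v) (N u e) = (\<Sum>f\<in>E. (2 * g (N e v) f) * (2 * g (N u e) f))" for e
    proof -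
      have "g (N e v) (N u e) = (\<Sum>f\<in>E. g (N e v) f * g (N u e) f)"
        by (subst parseval[symmetric]) (simp add: gsym[of _ "N u e"])
      then show ?thesis by (simp add: sum_distrib_left)
    qed
    moreover have "2 * g (N e v) f = - P v e f - P v f e - Q v e f"
      "2 * g (N u e) f = P u e f - P u f e - Q u e f" for e f
      unfolding K P_def Q_def
      by (simp_all add: Bskew[of e v] Bskew[of f e] Bskew[of f u] lins)
    ultimately have "4 * (\<Sum>e\<in>E. g (N e v) (N u e)) =
        (\<Sum>e\<in>E. \<Sum>f\<in>E. (- P v e f - P v f e - Q v e f) * (P u e f - P u f e - Q u e f))"
      by (simp add: sum_distrib_left)
    also have "\<dots> = (\<Sum>e\<in>E. \<Sum>f\<in>E. Q u e f * Q v e f)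
        - (\<Sum>e\<in>E. \<Sum>f\<in>E. Q v e f * P u e f) + (\<Sum>e\<in>E. \<Sum>f\<in>E. Q v e f * P u f e)
        - (\<Sum>e\<in>E. \<Sum>f\<in>E. (P v e f + P v f e) * (P u e f - P u f e - Q u e f))"
      by (simp add: sum.distrib[symmetric] sum_subtractf[symmetric] algebra_simps)
    also have "(\<Sum>e\<in>E. \<Sum>f\<in>E. Q v e f * P u f e) = - (\<Sum>e\<in>E. \<Sum>f\<in>E. Q v e f * P u e f)"
      by (subst sum.swap, subst Qsk) (simp add: sum_negf)
    also have "(\<Sum>e\<in>E. \<Sum>f\<in>E. (P v e f + P v f e) * (P u e f - P u f e - Q u e f)) = 0" (is "?X = 0")
    proof -
      have "?X = (\<Sum>e\<in>E. \<Sum>f\<in>E. (P v f e + P v e f) * (P u f e - P u e f - Q u f e))"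
        by (rule sum.swap)
      also have "\<dots> = (\<Sum>e\<in>E. \<Sum>f\<in>E. - ((P v e f + P v f e) * (P u e f - P u f e - Q u e f)))"
        by (intro sum.cong refl, subst Qsk) (simp add: algebra_simps)
      also have "\<dots> = - ?X" by (simp only: sum_negf)
      finally show ?thesis by simp
    qed
    also have "(\<Sum>e\<in>E. \<Sum>f\<in>E. Q v e f * P u e f) = S3"
    proof -
      have "(\<Sum>f\<in>E. Q v e f * P u e f) = g (B e (B u e)) v" for e
      proof -
        have "g (B e (B u e)) v = g (B e (\<Sum>f\<in>E. g (B u e) f *\<^sub>R f)) v" by (simp add: expand)
        then show ?thesis by (simp add: lins P_def Q_def mult.commute)
      qed
      then show ?thesis by (simp add: S3_def)
    qed
    finally show ?thesis by (simp add: S2_def)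
  qed
  finally have *: "ricci B g u v = - S1 / 2 + S2 / 4" by simp
  have "lin_trace (B u \<circ> adt v) = (\<Sum>e\<in>E. \<Sum>f\<in>E. g (adt v e) f * g (B u f) e)"
  proof -
    have "g (B u (adt v e)) e = (\<Sum>f\<in>E. g (adt v e) f * g (B u f) e)" for e
    proof -
      have "g (B u (adt v e)) e = g (B u (\<Sum>f\<in>E. g (adt v e) f *\<^sub>R f)) e" by (simp add: expand)
      then show ?thesis by (simp add: lins)
    qed
    then show ?thesis by (subst trace_eq) (simp_all add: lin adl linear_compose)
  qed
  also have "\<dots> = (\<Sum>f\<in>E. \<Sum>e\<in>E. g (B u f) e * g e (B v f))"
    by (subst sum.swap) (simp add: gsym[of "adt _ _"] adj[symmetric] gsym mult.commute)
  also have "\<dots> = S1" by (simp add: parseval S1_def)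
  finally have t1: "lin_trace (B u \<circ> adt v) = S1" .
  have "lin_trace ((\<lambda>x. adt x u) \<circ> (\<lambda>x. adt x v)) = (\<Sum>e\<in>E. \<Sum>f\<in>E. Q v e f * Q u f e)"
  proof -
    have "g (adt (adt e v) u) e = (\<Sum>f\<in>E. Q v e f * Q u f e)" for e
    proof -
      have "g (adt (adt e v) u) e = g (B (\<Sum>f\<in>E. g (adt e v) f *\<^sub>R f) e) u"
        by (subst expand) (simp add: gsym[of "adt _ _"] adj[symmetric])
      also have "\<dots> = (\<Sum>f\<in>E. g (adt e v) f * Q u f e)" by (simp add: lins Q_def)
      finally show ?thesis by (simp add: Q_def gsym[of "adt _ _"] adj[symmetric])
    qed
    then show ?thesis by (subst trace_eq) (simp_all add: adl linear_compose)
  qed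
  also have "\<dots> = - S2"
  proof -
    have "Q v e f * Q u f e = - (Q u e f * Q v e f)" for e f
      by (subst Qsk[of u f e]) simp
    then show ?thesis by (simp add: S2_def sum_negf)
  qed
  finally have t2: "lin_trace ((\<lambda>x. adt x u) \<circ> (\<lambda>x. adt x v)) = - S2" .
  show ?thesis by (simp add: * t1 t2)
qed

end

end

(* The free constant c absorbs s * lambda0, so the metric is Schouten like iff
   D = Ric - mu * id is a derivation for some real mu. Comparing coefficients of the symmetric
   map D, D [e1,e4] = 0 forces beta = 0, since Ric(e3,e4) is a multiple of alpha * beta; the
   e4-coefficient of D [e2,e3] forces delta = 0. Then D is diagonal and, up to the scaling by eta,
   the derivation property becomes
     -2 mu = 3 alpha^2 = 3 gamma^2 + epsilon^2 = 3 epsilon^2 + gamma^2. *)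
theory Submission
  imports Defs
begin

context orthonormal_lie_algebra
begin

section \<open>The Ricci form in terms of structure constants\<close>

lemma bilinear_eq_frame:
  assumes "bilinear f" and "bilinear h"
    and "\<And>x y. x \<in> E \<Longrightarrow> y \<in> E \<Longrightarrow> f x y = h x y"
  shows "f x y = h x y"
  using bilinear_eq[OF assms(1,2), of UNIV E UNIV E] assms(3) span by auto

text \<open>Eliminates the transpose from the nilpotent formula: both traces are expanded over
  \<open>E\<close>, so only structure constants in an orthonormal frame remain.\<close>

lemma ricci_sum:
  assumes tr1: "\<And>u. lin_trace (B u) = 0"
    and tr2: "\<And>u v. lin_trace (B u \<circ> B v) = 0"
  shows "ricci B g u v = (\<Sum>e\<in>E. \<Sum>f\<in>E. g (B e f) u * g (B e f) v) / 4
           - (\<Sum>e\<in>E. g (B u e) (B v e)) / 2"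
proof -
  \<comment> \<open>The Riesz vector of the functional \<open>x \<mapsto> g (B u x) y\<close>, that
    is, the transpose of ad_u applied to \<open>y\<close>.\<close>
  define adt where "adt = (\<lambda>u y. \<Sum>e\<in>E. g (B u e) y *\<^sub>R e)"
  have adt: "g (adt u y) x = g (B u x) y" for u x y
    unfolding adt_def by (rule riesz) (auto intro!: linearI simp: lins)
  have adj: "g (B u x) y = g x (adt u y)" for u x y
    by (simp add: adt gsym[of x])
  have adl: "linear (adt x)" "linear (\<lambda>x. adt x y)" for x y
    by (rule linearI; rule g_eqI; simp add: lins adt)+
  have "lin_trace (B u \<circ> adt v) = (\<Sum>e\<in>E. \<Sum>f\<in>E. g (B v f) e * g (B u f) e)"
  proof -
    have "g (B u (adt v e)) e = (\<Sum>f\<in>E. g (B v f) e * g (B u f) e)" for e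
      by (simp add: adt_def lins)
    then show ?thesis by (subst trace_eq) (simp_all add: lin adl linear_compose)
  qed
  \<comment> \<open>After the swap the inner sum over \<open>e\<close> is a Parseval
    expansion.\<close>
  also have "\<dots> = (\<Sum>f\<in>E. \<Sum>e\<in>E. g (B u f) e * g e (B v f))"
    by (subst sum.swap) (simp add: gsym mult.commute)
  also have "\<dots> = (\<Sum>e\<in>E. g (B u e) (B v e))" by (simp add: parseval)
  finally have t1: "lin_trace (B u \<circ> adt v) = (\<Sum>e\<in>E. g (B u e) (B v e))" .
  have "lin_trace ((\<lambda>x. adt x u) \<circ> (\<lambda>x. adt x v)) = (\<Sum>e\<in>E. \<Sum>f\<in>E. g (B e f) v * g (B f e) u)"
  proof -
    have "g (adt (adt e v) u) e = (\<Sum>f\<in>E. g (B e f) v * g (B f e) u)" for e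
      by (simp add: adt) (simp add: adt_def lins)
    then show ?thesis by (subst trace_eq) (simp_all add: adl linear_compose)
  qed
  also have "\<dots> = - (\<Sum>e\<in>E. \<Sum>f\<in>E. g (B e f) u * g (B e f) v)"
  proof -
    \<comment> \<open>Skew-symmetry of the bracket is what makes the J-part of the Ricci form enter
      with a positive sign.\<close>
    have "g (B e f) v * g (B f e) u = - (g (B e f) u * g (B e f) v)" for e f
      by (simp add: Bskew[of f e] lins)
    then show ?thesis by (simp add: sum_negf)
  qed
  finally show ?thesis using ricci_nilpotent[OF tr1 tr2 adj, of u v] t1 by simp
qed

text \<open>Allows identities for the Ricci form to be checked on frame vectors only.\<close>

lemma bilinear_ricci:
  assumes "\<And>u. lin_trace (B u) = 0"
    and "\<And>u v. lin_trace (B u \<circ> B v) = 0"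
  shows "bilinear (ricci B g)"
  unfolding bilinear_def
  by (auto simp: ricci_sum[OF assms] lins sum.distrib distrib_left distrib_right
      add_divide_distrib right_diff_distrib mult.assoc mult.left_commute sum_distrib_left intro!: linearI)

end

section \<open>Ricci curvature of A_{5,3} in an orthonormal frame\<close>

text \<open>The frame is orthonormal for \<open>g\<close> itself, so \<open>a\<close>,
  \<open>b\<close>, \<open>c\<close>, \<open>d\<close>, \<open>p\<close> stand for \<alpha>,
  \<beta>, \<gamma>, \<delta>, \<epsilon> after the factor \<eta> has been absorbed.\<close>

locale A53_frame =
  fixes B :: "'a::real_vector \<Rightarrow> 'a \<Rightarrow> 'a" and g :: "'a \<Rightarrow> 'a \<Rightarrow> real"
    and e1 e2 e3 e4 e5 :: 'a and a b c d p :: real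
  assumes lie_algebra: "lie_algebra B" and inner_product: "inner_product g"
    and span_frame: "span {e1, e2, e3, e4, e5} = UNIV"
    and unit: "g e1 e1 = 1" "g e2 e2 = 1" "g e3 e3 = 1" "g e4 e4 = 1" "g e5 e5 = 1"
    and orth: "g e1 e2 = 0" "g e1 e3 = 0" "g e1 e4 = 0" "g e1 e5 = 0" "g e2 e3 = 0"
      "g e2 e4 = 0" "g e2 e5 = 0" "g e3 e4 = 0" "g e3 e5 = 0" "g e4 e5 = 0"
    and bracket: "B e1 e2 = a *\<^sub>R e3 + b *\<^sub>R e4" "B e1 e3 = c *\<^sub>R e4 + d *\<^sub>R e5"
      "B e2 e3 = p *\<^sub>R e5"
      "B e1 e4 = 0" "B e1 e5 = 0" "B e2 e4 = 0" "B e2 e5 = 0" "B e3 e4 = 0" "B e3 e5 = 0"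
      "B e4 e5 = 0"
begin

lemma orth': "g e2 e1 = 0" "g e3 e1 = 0" "g e4 e1 = 0" "g e5 e1 = 0" "g e3 e2 = 0"
      "g e4 e2 = 0" "g e5 e2 = 0" "g e4 e3 = 0" "g e5 e3 = 0" "g e5 e4 = 0"
  using orth inner_product by (metis inner_product_def)+

sublocale orthonormal_lie_algebra B g "{e1, e2, e3, e4, e5}"
  by unfold_locales
    (use lie_algebra inner_product span_frame unit orth orth' in auto)

lemmas gram = unit orth orth'

lemma bracket': "B e2 e1 = - (a *\<^sub>R e3 + b *\<^sub>R e4)" "B e3 e1 = - (c *\<^sub>R e4 + d *\<^sub>R e5)"
      "B e3 e2 = - (p *\<^sub>R e5)"
      "B e4 e1 = 0" "B e5 e1 = 0" "B e4 e2 = 0" "B e5 e2 = 0" "B e4 e3 = 0" "B e5 e3 = 0"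
      "B e5 e4 = 0" "B e1 e1 = 0" "B e2 e2 = 0" "B e3 e3 = 0" "B e4 e4 = 0" "B e5 e5 = 0"
  using bracket Balt by (metis Bskew neg_equal_0_iff_equal)+

lemmas table = bracket bracket'

lemma sum_frame:
  fixes f :: "'a \<Rightarrow> 'b::comm_monoid_add"
  shows "(\<Sum>x\<in>{e1, e2, e3, e4, e5}. f x) = f e1 + f e2 + f e3 + f e4 + f e5"
proof -
  have "e1 \<noteq> e2" "e1 \<noteq> e3" "e1 \<noteq> e4" "e1 \<noteq> e5" "e2 \<noteq> e3" "e2 \<noteq> e4" "e2 \<noteq> e5"
    "e3 \<noteq> e4" "e3 \<noteq> e5" "e4 \<noteq> e5"
    using gram by auto
  then show ?thesis by (simp add: add.assoc)
qed

text \<open>Each ad_u is strictly triangular in the ordered frame \<open>e1\<close>, ...,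
  \<open>e5\<close>; by linearity in \<open>u\<close> the frame vectors suffice.\<close>

lemma trace_ad: "lin_trace (B u) = 0"
proof -
  have "lin_trace (B u) = (\<Sum>e\<in>{e1, e2, e3, e4, e5}. g (B u e) e)"
    by (rule trace_eq[OF lin(3)])
  also have "\<dots> = (\<Sum>f\<in>{e1, e2, e3, e4, e5}. g u f * (\<Sum>e\<in>{e1, e2, e3, e4, e5}. g (B f e) e))"
    by (subst expand[of u, symmetric]) (simp only: lins sum_frame; simp add: algebra_simps)
  also have "\<dots> = 0"
    by (simp add: sum_frame table lins gram)
  finally show ?thesis .
qed

text \<open>A product of two strictly triangular maps is again strictly triangular; bilinearity
  reduces the check to the frame.\<close>

lemma trace_ad_ad: "lin_trace (B u \<circ> B v) = 0"
proof -
  have "lin_trace (B u \<circ> B v) = (\<Sum>e\<in>{e1, e2, e3, e4, e5}. g (B u (B v e)) e)"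
    by (subst trace_eq) (simp_all add: lin linear_compose)
  also have "\<dots> = 0"
    by (rule bilinear_eq_frame[of "\<lambda>u v. \<Sum>e\<in>{e1, e2, e3, e4, e5}. g (B u (B v e)) e" "\<lambda>u v. 0"])
      (auto simp: bilinear_def lins sum_frame distrib_left table gram
        simp del: sum.insert intro!: linearI)
  finally show ?thesis .
qed

lemmas ricci_frame = ricci_sum[OF trace_ad trace_ad_ad]

lemmas bilinear_ricci_frame = bilinear_ricci[OF trace_ad trace_ad_ad]

text \<open>Every nonzero off-diagonal entry carries a factor \<open>b\<close> or \<open>d\<close>,
  so the frame diagonalizes the Ricci form once both vanish.\<close>

lemma ricci_table:
  "ricci B g e1 e1 = - (a\<^sup>2 + b\<^sup>2 + c\<^sup>2 + d\<^sup>2) / 2"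
  "ricci B g e2 e2 = - (a\<^sup>2 + b\<^sup>2 + p\<^sup>2) / 2"
  "ricci B g e3 e3 = (a\<^sup>2 - c\<^sup>2 - d\<^sup>2 - p\<^sup>2) / 2"
  "ricci B g e4 e4 = (b\<^sup>2 + c\<^sup>2) / 2"
  "ricci B g e5 e5 = (d\<^sup>2 + p\<^sup>2) / 2"
  "ricci B g e1 e2 = - (d * p) / 2" "ricci B g e2 e1 = - (d * p) / 2"
  "ricci B g e2 e3 = - (b * c) / 2" "ricci B g e3 e2 = - (b * c) / 2"
  "ricci B g e3 e4 = a * b / 2" "ricci B g e4 e3 = a * b / 2"
  "ricci B g e4 e5 = c * d / 2" "ricci B g e5 e4 = c * d / 2"
  "ricci B g e1 e3 = 0" "ricci B g e1 e4 = 0" "ricci B g e1 e5 = 0"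
  "ricci B g e2 e4 = 0" "ricci B g e2 e5 = 0" "ricci B g e3 e5 = 0"
  "ricci B g e3 e1 = 0" "ricci B g e4 e1 = 0" "ricci B g e5 e1 = 0"
  "ricci B g e4 e2 = 0" "ricci B g e5 e2 = 0" "ricci B g e5 e3 = 0"
  by (simp_all add: ricci_frame sum_frame table lins gram power2_eq_square add_divide_distrib diff_divide_distrib)

section \<open>Derivation conditions for the Schouten like property\<close>

lemma schouten_like_imp:
  assumes "schouten_like B g" and pos: "a > 0" "c > 0" "p > 0"
  shows "b = 0 \<and> d = 0 \<and> p = c \<and> 4 * c\<^sup>2 = 3 * a\<^sup>2"
proof -
  \<comment> \<open>Here \<mu> is the single number
    \<open>scalar_curvature B g * l0 + c\<close>.\<close>
  from assms(1) obtain D \<mu> where D: "derivation B D"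
    and ric: "\<And>X Y. ricci B g X Y = \<mu> * g X Y + g (D X) Y"
    unfolding schouten_like_def by blast
  have linD: "linear D" and der: "\<And>x y. D (B x y) = B (D x) y + B x (D y)"
    using D by (auto simp: derivation_def)
  note Dlins = linD[THEN linear_add] linD[THEN linear_scale] linD[THEN linear_0]
  have gD: "g (D X) Y = ricci B g X Y - \<mu> * g X Y" for X Y
    using ric[of X Y] by simp
  have De: "D x = g (D x) e1 *\<^sub>R e1 + g (D x) e2 *\<^sub>R e2 + g (D x) e3 *\<^sub>R e3 + g (D x) e4 *\<^sub>R e4
      + g (D x) e5 *\<^sub>R e5" for x
    using expand[of "D x"] by (simp only: sum_frame)
  note D_table = De[of e1, unfolded gD ricci_table gram] De[of e2, unfolded gD ricci_table gram]
    De[of e3, unfolded gD ricci_table gram] De[of e4, unfolded gD ricci_table gram]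
    De[of e5, unfolded gD ricci_table gram]
  \<comment> \<open>The left side vanishes. On the right only the \<open>e3\<close>-component
    \<open>a * b / 2\<close> of \<open>D e4\<close> contributes, giving
    \<open>a * b * c / 2\<close>.\<close>
  have "g (D (B e1 e4)) e4 = g (B (D e1) e4 + B e1 (D e4)) e4" by (simp only: der)
  then have b: "b = 0"
    using pos by (simp add: table D_table Dlins lins gram)
  \<comment> \<open>The left side is \<open>c * d * p / 2\<close>, from the
    \<open>e4\<close>-component of \<open>D e5\<close>; the right side is
    \<open>- c * d * p / 2\<close>, from the \<open>e1\<close>-component of
    \<open>D e2\<close>.\<close>
  have "g (D (B e2 e3)) e4 = g (B (D e2) e3 + B e2 (D e3)) e4" by (simp only: der)
  then have d: "d = 0"
    using pos by (simp add: table D_table Dlins lins gram field_simps)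
  have diag: "D e1 = g (D e1) e1 *\<^sub>R e1" "D e2 = g (D e2) e2 *\<^sub>R e2"
    "D e3 = g (D e3) e3 *\<^sub>R e3" "D e4 = g (D e4) e4 *\<^sub>R e4" "D e5 = g (D e5) e5 *\<^sub>R e5"
    by (subst De, simp add: gD ricci_table gram b d)+
  have Bdiag: "B (D e1) x = g (D e1) e1 *\<^sub>R B e1 x" "B (D e2) x = g (D e2) e2 *\<^sub>R B e2 x"
    "B x (D e2) = g (D e2) e2 *\<^sub>R B x e2" "B x (D e3) = g (D e3) e3 *\<^sub>R B x e3" for x
    by (metis diag lin(3,4) linear_scale)+
  \<comment> \<open>\<open>D\<close> is now diagonal, so each nonzero bracket makes eigenvalues add;
    positivity of \<open>a\<close>, \<open>c\<close> and \<open>p\<close> cancels the structure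
    constant in each of the three relations.\<close>
  have "g (D (B e1 e2)) e3 = g (B (D e1) e2) e3 + g (B e1 (D e2)) e3"
    by (simp only: der lins)
  then have 1: "g (D e3) e3 = g (D e1) e1 + g (D e2) e2"
    using pos by (simp add: Bdiag table Dlins lins gram b mult.commute[of _ a] flip: distrib_left)
  have "g (D (B e1 e3)) e4 = g (B (D e1) e3) e4 + g (B e1 (D e3)) e4"
    by (simp only: der lins)
  then have 2: "g (D e4) e4 = g (D e1) e1 + g (D e3) e3"
    using pos by (simp add: Bdiag table Dlins lins gram d mult.commute[of _ c] flip: distrib_left)
  have "g (D (B e2 e3)) e5 = g (B (D e2) e3) e5 + g (B e2 (D e3)) e5"
    by (simp only: der lins)
  then have 3: "g (D e5) e5 = g (D e2) e2 + g (D e3) e3"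
    using pos by (simp add: Bdiag table Dlins lins gram mult.commute[of _ p] flip: distrib_left)
  \<comment> \<open>The three eigenvalue relations, each solved for \<mu>; comparing the last two
    gives \<open>p\<^sup>2 = c\<^sup>2\<close>.\<close>
  have "2 * \<mu> = - 3 * a\<^sup>2" "2 * \<mu> = - (3 * c\<^sup>2 + p\<^sup>2)" "2 * \<mu> = - (3 * p\<^sup>2 + c\<^sup>2)"
    using 1 2 3 by (simp_all add: gD ricci_table gram b d field_simps)
  then have "p\<^sup>2 = c\<^sup>2" "4 * c\<^sup>2 = 3 * a\<^sup>2" by simp_all
  then show ?thesis using b d pos by simp
qed

lemma schouten_like_if:
  assumes "b = 0" "d = 0" "p = c" and ca: "4 * c\<^sup>2 = 3 * a\<^sup>2"
  shows "schouten_like B g"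
proof -
  \<comment> \<open>This is Ric + (3/2) a^2 id under the assumed relations. Its eigenvalues are
    proportional to 1, 1, 2, 3, 3, the weights of the grading in which \<open>e1\<close> and
    \<open>e2\<close> have weight 1; hence it is a derivation.\<close>
  define D where "D = (\<lambda>x. (5 / 8 * a\<^sup>2) *\<^sub>R (g x e1 *\<^sub>R e1 + g x e2 *\<^sub>R e2
    + (2 * g x e3) *\<^sub>R e3 + (3 * g x e4) *\<^sub>R e4 + (3 * g x e5) *\<^sub>R e5))"
  have linD: "linear D"
    by (rule linearI) (simp_all add: D_def lins algebra_simps add_divide_distrib)
  have D_table: "D e1 = (5 / 8 * a\<^sup>2) *\<^sub>R e1" "D e2 = (5 / 8 * a\<^sup>2) *\<^sub>R e2"
    "D e3 = (5 / 4 * a\<^sup>2) *\<^sub>R e3" "D e4 = (15 / 8 * a\<^sup>2) *\<^sub>R e4" "D e5 = (15 / 8 * a\<^sup>2) *\<^sub>R e5"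
    by (simp_all add: D_def gram)
  note Dlins = linD[THEN linear_add] linD[THEN linear_scale] linD[THEN linear_0]
    linD[THEN linear_neg]
  have "D (B x y) = B (D x) y + B x (D y)" for x y
    by (rule bilinear_eq_frame[of "\<lambda>x y. D (B x y)" "\<lambda>x y. B (D x) y + B x (D y)"])
      (auto simp: bilinear_def Dlins D_table lins table assms(1-3) algebra_simps
        simp flip: scaleR_left.add intro!: linearI)
  then have "derivation B D"
    using linD by (simp add: derivation_def)
  moreover have "g_symmetric g D"
    by (auto simp: g_symmetric_def D_def lins gsym algebra_simps)
  moreover have "ricci B g X Y = - (3 / 2 * a\<^sup>2) * g X Y + g (D X) Y" for X Y
  proof (rule bilinear_eq_frame[OF bilinear_ricci_frame])
    show "bilinear (\<lambda>X Y. - (3 / 2 * a\<^sup>2) * g X Y + g (D X) Y)"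
      by (auto simp: bilinear_def Dlins lins algebra_simps intro!: linearI)
  next
    fix x y assume "x \<in> {e1, e2, e3, e4, e5}" "y \<in> {e1, e2, e3, e4, e5}"
    then show "ricci B g x y = - (3 / 2 * a\<^sup>2) * g x y + g (D x) y"
      using ca by (auto simp: ricci_table D_table lins gram assms(1-3))
  qed
  ultimately show ?thesis
    unfolding schouten_like_def
    \<comment> \<open>With \<lambda>0 = 0 the scalar curvature drops out and the constant alone
      supplies \<mu>.\<close>
    by (intro exI[of _ "0::real"] exI[of _ "- (3 / 2 * a\<^sup>2)"] exI[of _ D]) auto
qed

end

section \<open>Transfer to the basis orthonormal for \<eta> g\<close>

theorem proposition9:
  fixes B :: "'a::real_vector \<Rightarrow> 'a \<Rightarrow> 'a"
    and g :: "'a \<Rightarrow> 'a \<Rightarrow> real"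
    and v :: "nat \<Rightarrow> 'a"
    and \<eta> \<alpha> \<beta> \<gamma> \<delta> \<epsilon> :: real
  assumes "is_A53 B"
    and "inner_product g"
    and "\<eta> > 0"
    and "basis5 v"
    and "orthonormal5 (\<lambda>x y. \<eta> * g x y) v"
    and "A53_brackets B v \<alpha> \<beta> \<gamma> \<delta> \<epsilon>"
    and "\<alpha> > 0" and "\<gamma> > 0" and "\<epsilon> > 0"
  shows "schouten_like B g \<longleftrightarrow>
    \<beta> = 0 \<and> \<delta> = 0 \<and> \<epsilon> = \<gamma> \<and> \<gamma> = sqrt 3 / 2 * \<alpha>"
proof -
  (* k * v i is orthonormal for g, and rescaling the frame multiplies the structure constants by k *)
  define k where "k = sqrt \<eta>"
  have k: "k > 0" "k * k = \<eta>" using assms(3) by (auto simp: k_def)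
  define e where "e = (\<lambda>i. k *\<^sub>R v i)"
  have lie: "lie_algebra B" using assms(1) by (simp add: is_A53_def)
  have lin: "linear (g x)" "linear (\<lambda>x. g x y)" "linear (B x)" "linear (\<lambda>x. B x y)" for x y
    using lie assms(2) by (auto simp: lie_algebra_def inner_product_def bilinear_def)
  note scale = lin[THEN linear_scale]
  have five: "{1..5} = {1, 2, 3, 4, 5::nat}" by auto
  have "v i = (1 / k) *\<^sub>R e i" for i using k by (simp add: e_def)
  then have "v i \<in> span {e 1, e 2, e 3, e 4, e 5}" if "i \<in> {1..5}" for i
    using that unfolding five by (metis span_base span_scale insert_iff emptyE)
  then have "span (v ` {1..5}) \<subseteq> span {e 1, e 2, e 3, e 4, e 5}"
    by (intro span_minimal) auto
  then have span: "span {e 1, e 2, e 3, e 4, e 5} = UNIV"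
    using assms(4) by (auto simp: basis5_def)
  interpret A53_frame B g "e 1" "e 2" "e 3" "e 4" "e 5"
    "k * \<alpha>" "k * \<beta>" "k * \<gamma>" "k * \<delta>" "k * \<epsilon>"
  proof
    show "lie_algebra B" "inner_product g" by fact+
    show "span {e 1, e 2, e 3, e 4, e 5} = UNIV" by fact
    have "g (e i) (e j) = (if i = j then 1 else 0)" if "i \<in> {1..5}" "j \<in> {1..5}" for i j
    proof -
      have "g (e i) (e j) = \<eta> * g (v i) (v j)"
        using k by (simp add: e_def scale)
      then show ?thesis using assms(5) that by (simp add: orthonormal5_def)
    qed
    then show "g (e 1) (e 1) = 1" "g (e 2) (e 2) = 1" "g (e 3) (e 3) = 1" "g (e 4) (e 4) = 1"
      "g (e 5) (e 5) = 1" "g (e 1) (e 2) = 0" "g (e 1) (e 3) = 0" "g (e 1) (e 4) = 0"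
      "g (e 1) (e 5) = 0" "g (e 2) (e 3) = 0" "g (e 2) (e 4) = 0" "g (e 2) (e 5) = 0"
      "g (e 3) (e 4) = 0" "g (e 3) (e 5) = 0" "g (e 4) (e 5) = 0"
      by simp_all
  qed (use assms(6) in \<open>simp_all add: A53_brackets_def e_def scale scaleR_add_right mult_ac\<close>)
  \<comment> \<open>The scaling factor cancels because the relation is homogeneous; positivity of
    \<alpha> and \<gamma> then selects the sign of the square root.\<close>
  have iff: "4 * (k * \<gamma>)\<^sup>2 = 3 * (k * \<alpha>)\<^sup>2 \<longleftrightarrow> \<gamma> = sqrt 3 / 2 * \<alpha>"
  proof -
    have "4 * (k * \<gamma>)\<^sup>2 = 3 * (k * \<alpha>)\<^sup>2 \<longleftrightarrow> (2 * \<gamma>)\<^sup>2 = (sqrt 3 * \<alpha>)\<^sup>2"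
      using k by (simp add: power_mult_distrib)
    also have "\<dots> \<longleftrightarrow> 2 * \<gamma> = sqrt 3 * \<alpha>"
      using assms(7,8) by (intro power2_eq_iff_nonneg) auto
    finally show ?thesis by auto
  qed
  show ?thesis
    using schouten_like_imp schouten_like_if iff k assms(7-9) by auto
qed

end
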